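(* Let $U_1\in\mathbb{R}$ and $U_2>0$. For every $s\in\mathbb{C}$ with $\operatorname{Re}(s)>0$, consider the cubic equation in $\lambda$ $$s+U_1\lambda+U_2\lambda^3=0,$$ whose three roots are $$\lambda_k(s)=\omega^{k-1}\zeta(s)-\frac{1}{3}\frac{U_1}{U_2}\frac{1}{\omega^{k-1}\zeta(s)},\qquad k=1,2,3,$$ with $\omega=\exp(2i\pi/3)$ and $$\zeta(s)=-\frac{1}{2^{1/3}}\left(\frac{s}{U_2}+\sqrt{\left(\frac{s}{U_2}\right)^2+\frac{4}{27}\left(\frac{U_1}{U_2}\right)^3}\,\right)^{1/3}.$$ Then, for every $s\in\mathbb{C}$ with $\operatorname{Re}(s)>0$, $$\operatorname{Re}(\lambda_1(s))<0,\qquad \operatorname{Re}(\lambda_2(s))>0,\qquad \operatorname{Re}(\lambda_3(s))>0.$$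
   Context: The square root $\sqrt{\cdot}$ and the cube root $(\cdot)^{1/3}$ of complex numbers denote the principal branches: for $w\neq 0$, $w^{\alpha}=\exp(\alpha \operatorname{Log} w)$ with $\operatorname{Im}\operatorname{Log} w\in(-\pi,\pi]$, and $\sqrt{0}=0$. *)

theory Defs
  imports
    "HOL-Analysis.Analysis"
    "HOL-Computational_Algebra.Computational_Algebra"
begin

(* poly (cubic U1 U2 s) x = s + U1 * x + U2 * x ^ 3 *)
definition cubic :: "real \<Rightarrow> real \<Rightarrow> complex \<Rightarrow> complex poly" where
  "cubic U1 U2 s = [:s, of_real U1, 0, of_real U2:]"

definition omega :: complex where
  "omega = exp (2 * \<i> * of_real pi / 3)"

(* csqrt is the principal square root with csqrt 0 = 0; for w \<noteq> 0, the complex power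
   w powr a is exp (a * ln w) with Im (ln w) in the half-open interval (-pi, pi]. *)
definition zeta :: "real \<Rightarrow> real \<Rightarrow> complex \<Rightarrow> complex" where
  "zeta U1 U2 s =
     - (1 / 2 powr (1 / 3)) *
       (s / of_real U2 +
        csqrt ((s / of_real U2)\<^sup>2 + 4 / 27 * (of_real U1 / of_real U2) ^ 3)) powr (1 / 3)"

(* The index k is 1, 2 or 3, so the truncated subtraction is exact. *)
definition lam :: "real \<Rightarrow> real \<Rightarrow> nat \<Rightarrow> complex \<Rightarrow> complex" where
  "lam U1 U2 k s =
     omega ^ (k - 1) * zeta U1 U2 s -
       1 / 3 * (of_real U1 / of_real U2) * (1 / (omega ^ (k - 1) * zeta U1 U2 s))"

end

theory Submission
  imports Defs
begin

text \<open>
  Dividing by \<open>U\<^sub>2\<close> and writing \<open>q = U\<^sub>1 / (3 U\<^sub>2)\<close>, each root has the form \<open>\<lambda> = \<nu> - q / \<nu>\<close> with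
  \<open>\<nu> = \<omega>\<^sup>j \<zeta>\<close>, so its real part is \<open>Re \<nu> (1 - q / |\<zeta>|\<^sup>2)\<close>. The radicand \<open>w\<close> of the cube root has positive
  real part, so \<open>-\<zeta>\<close> has argument in \<open>(-\<pi>/6, \<pi>/6)\<close>, which gives the sign of \<open>Re \<nu>\<close> for each \<open>j\<close>. The
  second factor is positive because \<open>|w|\<^sup>2 > 4 q\<^sup>3\<close>: for \<open>q > 0\<close>, the numbers \<open>\<sigma> = s / U\<^sub>2\<close> and \<open>r\<close> (the square
  root) satisfy \<open>(r + \<sigma>) (r - \<sigma>) = 4 q\<^sup>3\<close> and lie at an acute angle, so that \<open>|r - \<sigma>| < |r + \<sigma>|\<close>.
\<close>

lemma omega_eq_cis: "omega = cis (2 * pi / 3)"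
  by (simp add: omega_def cis_conv_exp mult_ac)

lemma omega_cubed: "omega ^ 3 = 1"
  by (simp add: omega_eq_cis Complex.DeMoivre)

lemma omega_quadratic: "1 + omega + omega ^ 2 = 0"
proof -
  have "omega \<noteq> 1"
    by (simp add: omega_eq_cis complex_eq_iff cos_120)
  moreover have "(omega - 1) * (1 + omega + omega ^ 2) = omega ^ 3 - 1"
    by (simp add: algebra_simps power2_eq_square power3_eq_cube)
  ultimately show ?thesis
    by (simp add: omega_cubed)
qed

lemma Re_omega_power_mult_exp:
  "Re (omega ^ k * exp z) = exp (Re z) * cos (2 * pi * k / 3 + Im z)"
  by (simp add: omega_eq_cis Complex.DeMoivre Re_exp Im_exp cos_add algebra_simps)

text \<open>This is Cardano's formula via Vieta: the three combinations have elementary symmetric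
  functions \<open>0\<close>, \<open>3 * z * e\<close> and \<open>z ^ 3 - e ^ 3\<close>, which are
  the coefficients of the monic cubic up to sign. Equality of multisets also accounts for multiple
  roots.\<close>

lemma proots_cubic:
  fixes z e s :: complex
  assumes U2: "U2 > 0"
    and prod: "3 * z * e = of_real (U1 / U2)" and cubes: "e ^ 3 - z ^ 3 = s / U2"
  shows "proots (cubic U1 U2 s) =
    {#z - e, omega * z - omega ^ 2 * e, omega ^ 2 * z - omega * e#}"
proof -
  let ?p = "\<lambda>x. [:- x, 1:] :: complex poly"
  let ?a = "z - e" and ?b = "omega * z - omega ^ 2 * e" and ?c = "omega ^ 2 * z - omega * e"
  have w2: "omega ^ 2 = - 1 - omega"
    using omega_quadratic by (simp add: algebra_simps eq_neg_iff_add_eq_0)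
  have sum: "?a + ?b + ?c = 0"
    unfolding w2 by (simp add: algebra_simps)
  have pairs: "?a * ?b + ?b * ?c + ?c * ?a = U1 / U2"
  proof -
    have "?a * ?b + ?b * ?c + ?c * ?a = 3 * z * e"
      using w2 by algebra
    then show ?thesis by (simp add: prod)
  qed
  have triple: "?a * ?b * ?c = - (s / U2)"
  proof -
    have "?a * ?b * ?c = z ^ 3 - e ^ 3"
      using w2 by algebra
    then show ?thesis by (simp flip: cubes)
  qed
  have "cubic U1 U2 s = smult U2 [:s / U2, U1 / U2, 0, 1:]"
    using U2 by (simp add: cubic_def)
  also have "[:s / U2, U1 / U2, 0, 1:] = [:- (?a * ?b * ?c), ?a * ?b + ?b * ?c + ?c * ?a, - (?a + ?b + ?c), 1:]"
    unfolding sum pairs triple by simp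
  also have "\<dots> = ?p ?a * ?p ?b * ?p ?c"
    by (simp add: algebra_simps)
  finally have "cubic U1 U2 s = smult U2 (?p ?a * ?p ?b * ?p ?c)" .
  then show ?thesis
    using U2 by (simp add: proots_mult del: mult_pCons_left mult_pCons_right)
qed

lemma Re_diff_of_real_divide:
  "Re (v - of_real q / v) = Re v * (1 - q / (cmod v)\<^sup>2)"
  by (simp add: Re_divide cmod_power2 algebra_simps)

lemma csqrt_sum_norm_gt:
  fixes \<sigma> :: complex and c :: real
  assumes \<sigma>: "Re \<sigma> > 0"
  shows "(cmod (\<sigma> + csqrt (\<sigma>\<^sup>2 + of_real c)))\<^sup>2 > c"
proof -
  define r where "r = csqrt (\<sigma>\<^sup>2 + of_real c)"
  have r0: "Re r \<ge> 0"
    using csqrt_principal unfolding r_def by (metis less_eq_real_def)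
  have r2: "r\<^sup>2 = \<sigma>\<^sup>2 + of_real c"
    by (simp add: r_def)
  have pos: "(cmod (\<sigma> + r))\<^sup>2 > 0"
    using \<sigma> r0 by (auto simp: complex_eq_iff)
  show ?thesis
  proof (cases "c > 0")
    case True
    have im: "Re r * Im r = Re \<sigma> * Im \<sigma>"
      using arg_cong[OF r2, of Im] by (simp add: power2_eq_square mult.commute)
    have re: "(Re r)\<^sup>2 - (Im r)\<^sup>2 = (Re \<sigma>)\<^sup>2 - (Im \<sigma>)\<^sup>2 + c"
      using arg_cong[OF r2, of Re] by (simp add: power2_eq_square)
    \<comment> \<open>If \<open>Re r = 0\<close>, then \<open>im\<close> forces
      \<open>Im \<sigma> = 0\<close>, and \<open>re\<close> equates a nonpositive number with a
      positive one.\<close>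
    have "Re r \<noteq> 0"
    proof
      assume "Re r = 0"
      with im re \<sigma> True have "- (Im r)\<^sup>2 = (Re \<sigma>)\<^sup>2 + c"
        by simp
      then show False
        using True by (smt (verit) zero_le_power2)
    qed
    with r0 have rpos: "Re r > 0" by simp
    \<comment> \<open>Multiplying by \<open>Re r\<close> lets \<open>im\<close> turn the product of
      imaginary parts into a square.\<close>
    have "Re r * (Im \<sigma> * Im r) = Re \<sigma> * (Im \<sigma>)\<^sup>2"
      using im by (simp add: power2_eq_square algebra_simps)
    also have "\<dots> \<ge> 0" using \<sigma> by simp
    finally have "Im \<sigma> * Im r \<ge> 0"
      using rpos by (simp add: zero_le_mult_iff)
    moreover have "Re \<sigma> * Re r > 0" using \<sigma> rpos by simp
    \<comment> \<open>The two squares differ by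
      \<open>4 * (Re \<sigma> * Re r + Im \<sigma> * Im r)\<close>.\<close>
    ultimately have "(cmod (r - \<sigma>))\<^sup>2 < (cmod (\<sigma> + r))\<^sup>2"
      unfolding cmod_power2 by (simp add: power2_eq_square algebra_simps)
    then have less: "cmod (r - \<sigma>) < cmod (\<sigma> + r)"
      by (rule power2_less_imp_less) simp
    have "(\<sigma> + r) * (r - \<sigma>) = of_real c"
      using r2 by (simp add: algebra_simps power2_eq_square)
    then have "c = cmod (\<sigma> + r) * cmod (r - \<sigma>)"
      using True by (metis norm_mult norm_of_real abs_of_pos)
    also have "\<dots> < (cmod (\<sigma> + r))\<^sup>2"
      using less pos by (simp add: power2_eq_square zero_less_mult_iff)
    finally show ?thesis by (simp add: r_def)
  next
    case False
    then show ?thesis using pos unfolding r_def by linarith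
  qed
qed

theorem theorem2p1:
  fixes U1 U2 :: real
  assumes "U2 > 0"
  shows "\<forall>s::complex. Re s > 0 \<longrightarrow>
           proots (cubic U1 U2 s) = {#lam U1 U2 1 s, lam U1 U2 2 s, lam U1 U2 3 s#} \<and>
           Re (lam U1 U2 1 s) < 0 \<and> Re (lam U1 U2 2 s) > 0 \<and> Re (lam U1 U2 3 s) > 0"
proof (intro allI impI)
  fix s :: complex
  assume s: "Re s > 0"
  define \<sigma> where "\<sigma> = s / of_real U2"
  define q where "q = U1 / U2 / 3"
  define r where "r = csqrt (\<sigma>\<^sup>2 + of_real (4 * q ^ 3))"
  define w where "w = \<sigma> + r"
  define \<zeta> where "\<zeta> = zeta U1 U2 s"
  have \<sigma>: "Re \<sigma> > 0"
    using s assms by (simp add: \<sigma>_def Re_divide_of_real)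
  have "Re r \<ge> 0"
    using csqrt_principal unfolding r_def by (metis less_eq_real_def)
  with \<sigma> have w: "Re w > 0" and w0: "w \<noteq> 0"
    by (auto simp: w_def complex_eq_iff)
  have wr: "w * (r - \<sigma>) = of_real (4 * q ^ 3)"
  proof -
    have "r\<^sup>2 = \<sigma>\<^sup>2 + of_real (4 * q ^ 3)" by (simp add: r_def)
    then show ?thesis by (simp add: w_def algebra_simps power2_eq_square)
  qed

  have "(2::complex) powr (1/3) = of_real (2 powr (1/3))"
    by (simp flip: powr_of_real)
  also have "\<dots> = exp (of_real (ln 2 / 3))"
    by (simp add: powr_def flip: exp_of_real)
  finally have two: "1 / (2::complex) powr (1/3) = exp (- of_real (ln 2 / 3))"
    by (simp add: exp_minus field_simps)
  \<comment> \<open>\<open>L\<close> is a logarithm of \<open>-\<zeta>\<close>. The real shift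
    absorbs the factor \<open>2 powr (1/3)\<close>, so \<open>Im L\<close> is a third of the
    argument of \<open>w\<close>.\<close>
  define L where "L = Ln w / 3 - of_real (ln 2 / 3)"
  have "4 / 27 * (of_real U1 / of_real U2) ^ 3 = (of_real (4 * q ^ 3) :: complex)"
    by (simp add: q_def power_divide)
  then have "\<zeta> = - (1 / 2 powr (1/3)) * w powr (1/3)"
    by (simp only: \<zeta>_def zeta_def w_def r_def \<sigma>_def)
  also have "\<dots> = - (exp (- of_real (ln 2 / 3)) * exp (Ln w / 3))"
    unfolding two using w0 by (simp add: powr_def)
  also have "\<dots> = - exp L"
    by (simp add: L_def flip: exp_add)
  finally have \<zeta>_exp: "\<zeta> = - exp L" .
  have "\<zeta> ^ 3 = - exp (3 * L)"
    by (simp add: \<zeta>_exp flip: exp_of_nat_mult)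
  also have "3 * L = Ln w - of_real (ln 2)"
    by (simp add: L_def)
  also have "exp \<dots> = w / 2"
    using w0 by (simp add: exp_diff exp_of_real)
  finally have \<zeta>3: "\<zeta> ^ 3 = - w / 2" by simp
  have \<zeta>0: "\<zeta> \<noteq> 0" by (simp add: \<zeta>_exp)

  have om0: "omega \<noteq> 0" using omega_cubed by auto
  have inv1: "1 / omega = omega ^ 2" and inv2: "1 / omega ^ 2 = omega"
    using omega_cubed om0 by (simp_all add: field_simps power2_eq_square power3_eq_cube)
  have lam: "lam U1 U2 k s = omega ^ (k - 1) * \<zeta> - of_real q / (omega ^ (k - 1) * \<zeta>)" for k
    by (simp add: lam_def \<zeta>_def q_def)

  have "proots (cubic U1 U2 s) = {#\<zeta> - q / \<zeta>, omega * \<zeta> - omega ^ 2 * (q / \<zeta>),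
          omega ^ 2 * \<zeta> - omega * (q / \<zeta>)#}"
  proof (rule proots_cubic[OF assms])
    show "3 * \<zeta> * (q / \<zeta>) = of_real (U1 / U2)"
      using \<zeta>0 by (simp add: q_def)
    \<comment> \<open>Divide \<open>wr\<close> by \<open>4 * \<zeta> ^ 3 = - 2 * w\<close>. Adding
      \<open>w / 2 = (\<sigma> + r) / 2\<close> then cancels \<open>r\<close> and leaves
      \<open>\<sigma>\<close>.\<close>
    have "(q / \<zeta>) ^ 3 = - (r - \<sigma>) / 2"
      using wr w0 by (simp add: power_divide \<zeta>3 field_simps)
    then show "(q / \<zeta>) ^ 3 - \<zeta> ^ 3 = s / U2"
      by (simp add: \<zeta>3 w_def field_simps flip: \<sigma>_def)
  qed
  also have "omega ^ 2 * (q / \<zeta>) = q / (omega * \<zeta>)"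
    by (simp flip: inv1)
  also have "omega * (q / \<zeta>) = q / (omega ^ 2 * \<zeta>)"
    by (subst inv2[symmetric]) simp
  finally have roots:
    "proots (cubic U1 U2 s) = {#lam U1 U2 1 s, lam U1 U2 2 s, lam U1 U2 3 s#}"
    by (simp add: lam)

  have factor: "1 - q / (cmod \<zeta>)\<^sup>2 > 0"
  proof -
    have "4 * q ^ 3 < (cmod w)\<^sup>2"
      using csqrt_sum_norm_gt[OF \<sigma>, of "4 * q ^ 3"] by (simp add: w_def r_def)
    also have "(cmod w)\<^sup>2 = 4 * ((cmod \<zeta>) ^ 3)\<^sup>2"
      by (simp add: \<zeta>3 norm_divide power_divide flip: norm_power)
    also have "((cmod \<zeta>) ^ 3)\<^sup>2 = ((cmod \<zeta>)\<^sup>2) ^ 3"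
      by (simp flip: power_mult)
    finally have "q ^ 3 < ((cmod \<zeta>)\<^sup>2) ^ 3" by simp
    \<comment> \<open>Only the larger base has to be nonnegative here, so negative \<open>q\<close>
      is covered too.\<close>
    then have "q < (cmod \<zeta>)\<^sup>2"
      by (rule power_less_imp_less_base) simp
    then show ?thesis using \<zeta>0 by simp
  qed
  have Re_lam: "Re (lam U1 U2 k s) = Re (omega ^ (k - 1) * \<zeta>) * (1 - q / (cmod \<zeta>)\<^sup>2)" for k
    unfolding lam Re_diff_of_real_divide
    by (simp add: norm_mult norm_power omega_eq_cis)
  have Re_nu: "Re (omega ^ k * \<zeta>) = - (exp (Re L) * cos (2 * pi * k / 3 + Im L))" for k
    using Re_omega_power_mult_exp[of k L] by (simp add: \<zeta>_exp)
  have "\<bar>Im (Ln w)\<bar> < pi / 2"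
    using Re_Ln_pos_lt[OF w0] w by simp
  then have arg: "- pi / 6 < Im L" "Im L < pi / 6"
    by (auto simp: L_def)
  have "cos (Im L) > 0"
    using arg pi_gt_zero by (intro cos_gt_zero_pi) linarith+
  then have neg0: "Re (omega ^ 0 * \<zeta>) < 0"
    unfolding Re_nu by simp
  have cos_neg: "cos x < 0" if "pi / 2 < x" "x < 3 * pi / 2" for x
    using cos_gt_zero_pi[of "x - pi"] that by (simp add: cos_diff)
  \<comment> \<open>The angles for exponents 1 and 2 lie in the open intervals from
    \<open>pi / 2\<close> to \<open>5 * pi / 6\<close> and from \<open>7 * pi / 6\<close> to
    \<open>3 * pi / 2\<close>. The cosine vanishes at \<open>pi / 2\<close> and
    \<open>3 * pi / 2\<close>, so the strict bounds in \<open>arg\<close> matter.\<close>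
  have "cos (2 * pi * real 1 / 3 + Im L) < 0"
    using arg by (intro cos_neg) auto
  then have pos1: "Re (omega ^ 1 * \<zeta>) > 0"
    unfolding Re_nu by (metis exp_gt_zero mult_pos_neg neg_0_less_iff_less)
  have "cos (2 * pi * real 2 / 3 + Im L) < 0"
    using arg by (intro cos_neg) auto
  then have pos2: "Re (omega ^ 2 * \<zeta>) > 0"
    unfolding Re_nu by (metis exp_gt_zero mult_pos_neg neg_0_less_iff_less)
  show "proots (cubic U1 U2 s) = {#lam U1 U2 1 s, lam U1 U2 2 s, lam U1 U2 3 s#} \<and>
      Re (lam U1 U2 1 s) < 0 \<and> Re (lam U1 U2 2 s) > 0 \<and> Re (lam U1 U2 3 s) > 0"
    using roots factor neg0 pos1 pos2 by (simp add: Re_lam mult_neg_pos)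
qed

end
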